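(* Let $T>0$, let $W=(W^1,W^2)$ be a standard two-dimensional Brownian motion, and let $(x,y)$ be the solution on $[0,T]$ of the Stratonovich SDE $$dx_t=dW_t^1,\qquad dy_t=x_t\circ dW_t^2,\qquad (x_0,y_0)=(0,0).$$ For an integer $N\ge1$, set $h=T/N$, $t_k:=kh$, $t_{k+\frac12}:=(k+\tfrac12)h$, and write $W^i_{s,t}:=W^i_t-W^i_s$. Define $\{(X_k,Y_k)\}_{0\le k\le N}$ by $(X_0,Y_0):=(0,0)$ and, for $0\le k<N$, $$X_{k+1}:=X_k+W^1_{t_{k+1}}-W^1_{t_k},$$ $$Y_{k+1}:=\max\bigg(Y_k+\frac12\big(W^1_{t_k}+W^1_{t_{k+1}}\big)\big(W^2_{t_{k+1}}-W^2_{t_k}\big),\;\; Y_k+\frac12\big(W^1_{t_k}+W^1_{t_{k+\frac12}}\big)W^2_{t_k,t_{k+\frac12}}+\frac12\big(W^1_{t_{k+\frac12}}+W^1_{t_{k+1}}\big)W^2_{t_{k+\frac12},t_{k+1}}\bigg).$$ Then $$\mathbb{E}[y_T]=0,\qquad \mathbb{E}[Y_N]=\frac18T.$$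
   Context: $\circ\,dW$ denotes Stratonovich integration. The two arguments of the maximum are the results of propagating the $y$-component by one step of size $h$, respectively two steps of size $h/2$, of Heun's method. *)

theory Defs
  imports "HOL-Probability.Probability"
begin

text \<open>One-dimensional standard Brownian motion. A process is indexed by all reals, but only its
  values at times in \<^term>\<open>{0..} :: real set\<close> are constrained.\<close>

definition brownian_motion :: "'a measure \<Rightarrow> (real \<Rightarrow> 'a \<Rightarrow> real) \<Rightarrow> bool" where
  "brownian_motion M B \<longleftrightarrow>
     prob_space M \<and>
     (\<forall>t\<ge>0. B t \<in> borel_measurable M) \<and>
     (AE \<omega> in M. B 0 \<omega> = 0) \<and>
     (AE \<omega> in M. continuous_on {0..} (\<lambda>t. B t \<omega>)) \<and>
     (\<forall>s t. 0 \<le> s \<and> s < t \<longrightarrow>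
        distributed M lborel (\<lambda>\<omega>. B t \<omega> - B s \<omega>) (normal_density 0 (sqrt (t - s)))) \<and>
     (\<forall>n p. 0 \<le> p 0 \<and> (\<forall>k<n. p k \<le> p (Suc k)) \<longrightarrow>
        prob_space.indep_vars M (\<lambda>_. borel) (\<lambda>k \<omega>. B (p (Suc k)) \<omega> - B (p k) \<omega>) {..<n::nat})"

text \<open>The coordinates are independent as processes, i.e. as random elements of the product
  space of functions on \<^term>\<open>{0..} :: real set\<close>.\<close>

definition std_brownian_motion :: "'a measure \<Rightarrow> (real \<Rightarrow> 'a \<Rightarrow> real ^ 'n::finite) \<Rightarrow> bool" where
  "std_brownian_motion M W \<longleftrightarrow>
     (\<forall>i. brownian_motion M (\<lambda>t \<omega>. W t \<omega> $ i)) \<and>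
     prob_space.indep_vars M (\<lambda>i. \<Pi>\<^sub>M t\<in>{0..}. borel) (\<lambda>i \<omega>. \<lambda>t\<in>{0..}. W t \<omega> $ i) UNIV"

definition is_partition :: "real \<Rightarrow> real \<Rightarrow> nat \<Rightarrow> (nat \<Rightarrow> real) \<Rightarrow> bool" where
  "is_partition a b n p \<longleftrightarrow> p 0 = a \<and> p n = b \<and> (\<forall>k<n. p k \<le> p (Suc k))"

text \<open>The random variable \<open>J\<close> is the Stratonovich integral of \<open>H\<close> against \<open>Z\<close> over
  \<open>[a, b]\<close>: the limit in probability of the sums
  \<open>\<Sum> 1/2 (H(p\<^sub>k) + H(p\<^sub>k\<^sub>+\<^sub>1)) (Z(p\<^sub>k\<^sub>+\<^sub>1) - Z(p\<^sub>k))\<close> as the mesh of the partition \<open>p\<close> tends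
  to 0. It is determined only up to almost sure equality, hence a relation.\<close>

definition has_stratonovich_integral ::
  "'a measure \<Rightarrow> (real \<Rightarrow> 'a \<Rightarrow> real) \<Rightarrow> (real \<Rightarrow> 'a \<Rightarrow> real) \<Rightarrow> real \<Rightarrow> real \<Rightarrow> ('a \<Rightarrow> real) \<Rightarrow> bool"
where
  "has_stratonovich_integral M H Z a b J \<longleftrightarrow>
     (\<forall>t\<in>{a..b}. H t \<in> borel_measurable M \<and> Z t \<in> borel_measurable M) \<and>
     J \<in> borel_measurable M \<and>
     (\<forall>\<epsilon>>0. \<forall>\<eta>>0. \<exists>\<delta>>0. \<forall>n p.
        is_partition a b n p \<and> (\<forall>k<n. p (Suc k) - p k < \<delta>) \<longrightarrow>
        measure M {\<omega> \<in> space M.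
          \<bar>(\<Sum>k<n. (H (p k) \<omega> + H (p (Suc k)) \<omega>) / 2 * (Z (p (Suc k)) \<omega> - Z (p k) \<omega>)) - J \<omega>\<bar> > \<epsilon>}
          < \<eta>)"

text \<open>\<open>(x, y)\<close> solves \<open>dx = dW\<^sup>1\<close>, \<open>dy = x \<circ> dW\<^sup>2\<close>, \<open>(x, y)(0) = (0, 0)\<close> on \<open>[0, T]\<close>. No filtration
  is needed: the two integral equations force \<open>x\<close> and \<open>y\<close> to be adapted to the completed
  filtration generated by \<open>W\<close>.\<close>

definition strat_sde_solution ::
  "'a measure \<Rightarrow> (real \<Rightarrow> 'a \<Rightarrow> real ^ 2) \<Rightarrow> real \<Rightarrow> (real \<Rightarrow> 'a \<Rightarrow> real) \<Rightarrow> (real \<Rightarrow> 'a \<Rightarrow> real) \<Rightarrow> bool"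
where
  "strat_sde_solution M W T x y \<longleftrightarrow>
     (\<forall>t\<in>{0..T}. x t \<in> borel_measurable M \<and> y t \<in> borel_measurable M) \<and>
     (AE \<omega> in M. continuous_on {0..T} (\<lambda>t. x t \<omega>) \<and> continuous_on {0..T} (\<lambda>t. y t \<omega>)) \<and>
     (AE \<omega> in M. x 0 \<omega> = 0 \<and> y 0 \<omega> = 0) \<and>
     (\<forall>t\<in>{0..T}. AE \<omega> in M. x t \<omega> - x 0 \<omega> = W t \<omega> $ 1 - W 0 \<omega> $ 1) \<and>
     (\<forall>t\<in>{0..T}. has_stratonovich_integral M x (\<lambda>s \<omega>. W s \<omega> $ 2) 0 t (\<lambda>\<omega>. y t \<omega> - y 0 \<omega>))"

end

theory Submission
  imports Defs
begin

text \<open>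
  Since \<open>max u v = (u + v + \<bar>u - v\<bar>) / 2\<close>, and both candidate increments of one step have mean 0
  by independence of the coordinates, only the absolute difference contributes. If \<open>u\<^sub>1, u\<^sub>2\<close>
  and \<open>v\<^sub>1, v\<^sub>2\<close> are the increments of the two coordinates over the two half steps, that difference is
  \<open>(u\<^sub>2 v\<^sub>1 - u\<^sub>1 v\<^sub>2) / 2\<close>. Given \<open>v\<close>, the determinant is centred normal with variance
  \<open>(v\<^sub>1\<^sup>2 + v\<^sub>2\<^sup>2) h / 2\<close>, so its mean absolute value is \<open>sqrt (2 / pi)\<close> times \<open>sqrt (h / 2)\<close> times the
  mean \<open>sqrt (h / 2) sqrt (pi / 2)\<close> of a Rayleigh variable, that is \<open>h / 2\<close>; each step contributes
  \<open>h / 8\<close>.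

  The Stratonovich sums for \<open>y\<close> have mean 0 and are bounded in \<open>L\<^sup>2\<close>, because increments of
  the second coordinate are orthogonal and independent of the first. An \<open>L\<^sup>2\<close> bound makes
  convergence in probability preserve means.
\<close>

section \<open>Gaussian and Cauchy integrals on the real line\<close>

text \<open>\<open>arctan\<close> is a primitive on the half line, and evenness doubles its limit pi
  / 2. This is the weight that remains in the slope variable when the mean radius is computed
  below.\<close>

lemma has_bochner_integral_inverse_1_plus_square:
  "has_bochner_integral lborel (\<lambda>s::real. 1 / (1 + s\<^sup>2)) pi"
proof -
  have "(\<integral>\<^sup>+s. ennreal (1 / (1 + s\<^sup>2)) * indicator {0..} s \<partial>lborel) = ennreal (pi / 2 - arctan 0)"
  proof (rule nn_integral_FTC_atLeast)
    show "(arctan \<longlongrightarrow> pi / 2) at_top"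
      by (rule tendsto_arctan_at_top)
  qed (auto intro!: derivative_eq_intros simp: field_simps add_nonneg_eq_0_iff)
  then have "has_bochner_integral lborel (\<lambda>s::real. indicator {0..} s *\<^sub>R (1 / (1 + s\<^sup>2))) (pi / 2)"
    by (intro has_bochner_integral_nn_integral)
       (auto simp: indicator_mult_ennreal ac_simps intro!: borel_measurable_divide borel_measurable_indicator)
  then have "has_bochner_integral lborel (\<lambda>s::real. 1 / (1 + s\<^sup>2)) (2 *\<^sub>R (pi / 2))"
    by (rule has_bochner_integral_even_function) simp
  then show ?thesis
    by simp
qed

lemma normal_second_moment:
  assumes "0 < \<sigma>"
  shows "has_bochner_integral lborel (\<lambda>x. normal_density 0 \<sigma> x * x\<^sup>2) (\<sigma>\<^sup>2)"
  using normal_moment_even[OF assms, of 0 1] assms by simp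

lemma nn_integral_normal_radius:
  assumes "0 < \<sigma>"
  shows "(\<integral>\<^sup>+x. \<integral>\<^sup>+z. ennreal (normal_density 0 \<sigma> x * normal_density 0 \<sigma> z * sqrt (x\<^sup>2 + z\<^sup>2))
            \<partial>lborel \<partial>lborel) = ennreal (\<sigma> * sqrt (pi / 2))" (is "?L = _")
proof -
  \<comment> \<open>The substitution \<open>z = x s\<close> replaces polar coordinates and leaves a Cauchy integral in \<open>s\<close>.\<close>
  let ?\<tau> = "\<lambda>s::real. \<sigma> / sqrt (1 + s\<^sup>2)"
  let ?c = "1 / (\<sigma> * sqrt (2 * pi))"
  have pos: "0 < 1 + s\<^sup>2" for s :: real
    by (simp add: add_pos_nonneg)
  \<comment> \<open>The leading \<open>\<bar>x\<bar>\<close> is the Jacobian and the radius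
    contributes a second one. At the point \<open>(x, x * s)\<close> the two exponents add up to
    that of a normal density in \<open>x\<close> with deviation \<open>?\<tau> s\<close>, whose
    normalising constant absorbs the factor \<open>sqrt (1 + s\<^sup>2)\<close> of the
    radius.\<close>
  have key: "\<bar>x\<bar> * (normal_density 0 \<sigma> x * normal_density 0 \<sigma> (x * s) * sqrt (x\<^sup>2 + (x * s)\<^sup>2))
      = ?c * (normal_density 0 (?\<tau> s) x * x\<^sup>2)" for x s :: real
  proof -
    have "x\<^sup>2 + (x * s)\<^sup>2 = x\<^sup>2 * (1 + s\<^sup>2)"
      by (simp add: power_mult_distrib algebra_simps)
    then have r: "sqrt (x\<^sup>2 + (x * s)\<^sup>2) = \<bar>x\<bar> * sqrt (1 + s\<^sup>2)"
      by (simp add: real_sqrt_mult)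
    have e: "exp (- x\<^sup>2 / (2 * \<sigma>\<^sup>2)) * exp (- (x * s)\<^sup>2 / (2 * \<sigma>\<^sup>2)) = exp (- x\<^sup>2 / (2 * (?\<tau> s)\<^sup>2))"
      using assms pos[of s]
      by (simp add: exp_add[symmetric] power_mult_distrib power_divide field_simps)
    have n: "normal_density 0 (?\<tau> s) x = sqrt (1 + s\<^sup>2) * ?c * exp (- x\<^sup>2 / (2 * (?\<tau> s)\<^sup>2))"
      using assms pos[of s]
      by (simp add: normal_density_def real_sqrt_mult real_sqrt_divide power_divide)
    have "normal_density 0 \<sigma> x * normal_density 0 \<sigma> (x * s)
       = ?c * ?c * exp (- x\<^sup>2 / (2 * (?\<tau> s)\<^sup>2))"
      using assms unfolding e[symmetric] by (simp add: normal_density_def real_sqrt_mult)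
    then show ?thesis
      unfolding n r by (simp add: power2_eq_square)
  qed
  \<comment> \<open>The substitution degenerates at \<open>x = 0\<close>, so the inner integrals are
    compared only off this null set.\<close>
  have "?L = (\<integral>\<^sup>+x. \<integral>\<^sup>+s. ennreal (?c * (normal_density 0 (?\<tau> s) x * x\<^sup>2)) \<partial>lborel \<partial>lborel)"
  proof (rule nn_integral_cong_AE)
    have "(\<integral>\<^sup>+z. ennreal (normal_density 0 \<sigma> x * normal_density 0 \<sigma> z * sqrt (x\<^sup>2 + z\<^sup>2)) \<partial>lborel)
        = (\<integral>\<^sup>+s. ennreal (?c * (normal_density 0 (?\<tau> s) x * x\<^sup>2)) \<partial>lborel)" if "x \<noteq> 0" for x
      using that unfolding key[symmetric]
      by (subst nn_integral_real_affine[where t=0 and c=x])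
         (auto simp: nn_integral_cmult[symmetric] ennreal_mult'[symmetric])
    then show "AE x in lborel.
        (\<integral>\<^sup>+z. ennreal (normal_density 0 \<sigma> x * normal_density 0 \<sigma> z * sqrt (x\<^sup>2 + z\<^sup>2)) \<partial>lborel)
        = (\<integral>\<^sup>+s. ennreal (?c * (normal_density 0 (?\<tau> s) x * x\<^sup>2)) \<partial>lborel)"
      using AE_lborel_singleton[of 0] by (auto elim: eventually_mono)
  qed
  \<comment> \<open>With the order exchanged, the inner integral is the second moment of a normal
    density, the square of \<open>?\<tau> s\<close>; it produces the Cauchy weight in
    \<open>s\<close>.\<close>
  also have "\<dots> = (\<integral>\<^sup>+s. \<integral>\<^sup>+x. ennreal (?c * (normal_density 0 (?\<tau> s) x * x\<^sup>2)) \<partial>lborel \<partial>lborel)"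
    by (rule lborel_pair.Fubini'[symmetric]) (simp add: normal_density_def)
  also have "\<dots> = (\<integral>\<^sup>+s. ennreal (\<sigma> / sqrt (2 * pi)) * ennreal (1 / (1 + s\<^sup>2)) \<partial>lborel)"
  proof (rule nn_integral_cong)
    fix s :: real
    have "(\<integral>\<^sup>+x. ennreal (?c * (normal_density 0 (?\<tau> s) x * x\<^sup>2)) \<partial>lborel)
        = ennreal ?c * (\<integral>\<^sup>+x. ennreal (normal_density 0 (?\<tau> s) x * x\<^sup>2) \<partial>lborel)"
      using assms by (subst nn_integral_cmult[symmetric]) (auto simp: ennreal_mult'[symmetric])
    also have "\<dots> = ennreal (?c * (?\<tau> s)\<^sup>2)"
      using assms pos[of s] by (subst nn_integral_eq_integral)
        (auto simp: normal_second_moment[THEN has_bochner_integral_integral_eq]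
          normal_second_moment[THEN integrable.intros] ennreal_mult'[symmetric])
    also have "?c * (?\<tau> s)\<^sup>2 = \<sigma> / sqrt (2 * pi) * (1 / (1 + s\<^sup>2))"
      using assms pos[of s] by (simp add: power_divide) (simp add: power2_eq_square)
    finally show "(\<integral>\<^sup>+x. ennreal (?c * (normal_density 0 (?\<tau> s) x * x\<^sup>2)) \<partial>lborel)
        = ennreal (\<sigma> / sqrt (2 * pi)) * ennreal (1 / (1 + s\<^sup>2))"
      using assms by (simp add: ennreal_mult'[symmetric])
  qed
  also have "\<dots> = ennreal (\<sigma> / sqrt (2 * pi)) * ennreal pi"
    using has_bochner_integral_inverse_1_plus_square
    by (subst nn_integral_cmult) (auto simp: nn_integral_eq_integral has_bochner_integral_iff)
  also have "\<dots> = ennreal (\<sigma> * sqrt (pi / 2))"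
  proof -
    have "pi = sqrt pi * sqrt pi" by simp
    then have "\<sigma> / sqrt (2 * pi) * pi = \<sigma> * sqrt (pi / 2)"
      by (simp add: real_sqrt_mult real_sqrt_divide field_simps)
    then show ?thesis
      using assms by (simp add: ennreal_mult'[symmetric])
  qed
  finally show ?thesis .
qed

section \<open>Absolute means of Gaussian combinations and determinants\<close>

context prob_space
begin

lemma nn_integral_normal_abs:
  assumes "0 < \<sigma>" and D: "distributed M lborel Z (normal_density 0 \<sigma>)"
  shows "(\<integral>\<^sup>+\<omega>. ennreal \<bar>Z \<omega>\<bar> \<partial>M) = ennreal (\<sigma> * sqrt (2 / pi))"
proof -
  have "has_bochner_integral lborel (\<lambda>x. normal_density 0 \<sigma> x * \<bar>x\<bar>) (\<sigma> * sqrt (2 / pi))"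
    using normal_moment_abs_odd[OF assms(1), of 0 0] by simp
  then have "(\<integral>\<^sup>+x. ennreal (normal_density 0 \<sigma> x * \<bar>x\<bar>) \<partial>lborel) = ennreal (\<sigma> * sqrt (2 / pi))"
    by (simp add: nn_integral_eq_integral has_bochner_integral_iff)
  then show ?thesis
    using distributed_nn_integral[OF D, of "\<lambda>x. ennreal \<bar>x\<bar>"]
    by (simp add: ennreal_mult'')
qed

lemma nn_integral_normal_linear_combination_abs:
  assumes "0 < \<sigma>" and ind: "indep_var borel X borel Z"
    and X: "distributed M lborel X (normal_density 0 \<sigma>)"
    and Z: "distributed M lborel Z (normal_density 0 \<sigma>)"
  shows "(\<integral>\<^sup>+\<omega>. ennreal \<bar>a * X \<omega> + b * Z \<omega>\<bar> \<partial>M) = ennreal (\<sigma> * sqrt (2 / pi) * sqrt (a\<^sup>2 + b\<^sup>2))"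
proof -
  have scaled: "distributed M lborel (\<lambda>\<omega>. c * V \<omega>) (normal_density 0 (\<bar>c\<bar> * \<sigma>))"
    if "c \<noteq> 0" "distributed M lborel V (normal_density 0 \<sigma>)" for c V
    using normal_density_affine[OF that(2) assms(1) that(1), of 0] by simp
  have one: "(\<integral>\<^sup>+\<omega>. ennreal \<bar>c * V \<omega>\<bar> \<partial>M) = ennreal (\<sigma> * sqrt (2 / pi) * sqrt (c\<^sup>2))"
    if "distributed M lborel V (normal_density 0 \<sigma>)" for c V
  proof (cases "c = 0")
    case False
    then show ?thesis
      using nn_integral_normal_abs[OF _ scaled[OF False that]] assms(1) by (simp add: ac_simps)
  qed simp
  \<comment> \<open>The sum rule for independent normals needs two positive deviations. If a
    coefficient vanishes, one scaled variable is left and \<open>one\<close> applies.\<close>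
  consider "a = 0" | "b = 0" | "a \<noteq> 0" "b \<noteq> 0" by blast
  then show ?thesis
  proof cases
    case 3
    have "indep_var borel ((\<lambda>x. a * x) \<circ> X) borel ((\<lambda>x. b * x) \<circ> Z)"
      by (rule indep_var_compose[OF ind]) auto
    then have "distributed M lborel (\<lambda>\<omega>. a * X \<omega> + b * Z \<omega>)
        (normal_density (0 + 0) (sqrt ((\<bar>a\<bar> * \<sigma>)\<^sup>2 + (\<bar>b\<bar> * \<sigma>)\<^sup>2)))"
      using 3 assms(1) scaled[OF _ X] scaled[OF _ Z]
      by (intro add_indep_normal) (auto simp: comp_def)
    moreover have "sqrt ((\<bar>a\<bar> * \<sigma>)\<^sup>2 + (\<bar>b\<bar> * \<sigma>)\<^sup>2) = \<sigma> * sqrt (a\<^sup>2 + b\<^sup>2)"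
    proof -
      have "(\<bar>a\<bar> * \<sigma>)\<^sup>2 + (\<bar>b\<bar> * \<sigma>)\<^sup>2 = \<sigma>\<^sup>2 * (a\<^sup>2 + b\<^sup>2)"
        by (simp add: power_mult_distrib algebra_simps)
      then show ?thesis using assms(1) by (simp add: real_sqrt_mult)
    qed
    ultimately have "distributed M lborel (\<lambda>\<omega>. a * X \<omega> + b * Z \<omega>)
        (normal_density 0 (\<sigma> * sqrt (a\<^sup>2 + b\<^sup>2)))"
      by simp
    moreover have "0 < \<sigma> * sqrt (a\<^sup>2 + b\<^sup>2)"
      using 3 assms(1) by (simp add: sum_power2_gt_zero_iff)
    ultimately show ?thesis
      using nn_integral_normal_abs by (simp add: ac_simps)
  qed (use one[OF X, of a] one[OF Z, of b] in simp_all)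
qed

text \<open>Independence makes the joint law a product measure, to which Tonelli applies. The lemma
  plays the role of conditioning: in the inner integral \<open>Y\<close> is frozen at
  \<open>\<omega>'\<close>.\<close>

lemma nn_integral_indep_var:
  assumes ind: "indep_var S X T' Y" and f[measurable]: "f \<in> borel_measurable (S \<Otimes>\<^sub>M T')"
  shows "(\<integral>\<^sup>+\<omega>. f (X \<omega>, Y \<omega>) \<partial>M) = (\<integral>\<^sup>+\<omega>'. \<integral>\<^sup>+\<omega>. f (X \<omega>, Y \<omega>') \<partial>M \<partial>M)"
proof -
  have [measurable]: "X \<in> measurable M S" "Y \<in> measurable M T'"
    and eq: "distr M S X \<Otimes>\<^sub>M distr M T' Y = distr M (S \<Otimes>\<^sub>M T') (\<lambda>x. (X x, Y x))"
    using ind unfolding indep_var_distribution_eq by auto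
  interpret X: prob_space "distr M S X" by (rule prob_space_distr) simp
  interpret Y: prob_space "distr M T' Y" by (rule prob_space_distr) simp
  interpret P: pair_sigma_finite "distr M S X" "distr M T' Y" ..
  have "(\<integral>\<^sup>+\<omega>. f (X \<omega>, Y \<omega>) \<partial>M) = (\<integral>\<^sup>+z. f z \<partial>(distr M S X \<Otimes>\<^sub>M distr M T' Y))"
    unfolding eq by (simp add: nn_integral_distr)
  also have "\<dots> = (\<integral>\<^sup>+y. \<integral>\<^sup>+x. f (x, y) \<partial>distr M S X \<partial>distr M T' Y)"
    by (rule P.nn_integral_snd[symmetric]) simp
  also have "\<dots> = (\<integral>\<^sup>+\<omega>'. \<integral>\<^sup>+x. f (x, Y \<omega>') \<partial>distr M S X \<partial>M)"
    by (subst nn_integral_distr) simp_all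
  also have "\<dots> = (\<integral>\<^sup>+\<omega>'. \<integral>\<^sup>+\<omega>. f (X \<omega>, Y \<omega>') \<partial>M \<partial>M)"
  proof (rule nn_integral_cong)
    fix \<omega>' assume "\<omega>' \<in> space M"
    then have [measurable]: "Y \<omega>' \<in> space T'"
      by (rule measurable_space[rotated]) simp
    show "(\<integral>\<^sup>+x. f (x, Y \<omega>') \<partial>distr M S X) = (\<integral>\<^sup>+\<omega>. f (X \<omega>, Y \<omega>') \<partial>M)"
      by (rule nn_integral_distr) simp_all
  qed
  finally show ?thesis .
qed

text \<open>With the \<open>V\<close> pair frozen, the determinant is a linear combination of
  independent normals, so its mean absolute value is a multiple of the radius of the
  \<open>V\<close> pair. Averaging the radius brings the factor sqrt (pi / 2), which cancels sqrt (2
  / pi).\<close>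

lemma nn_integral_normal_determinant_abs:
  assumes "0 < \<sigma>"
    and U: "indep_var borel U1 borel U2" and V: "indep_var borel V1 borel V2"
    and UV: "indep_var (borel \<Otimes>\<^sub>M borel) (\<lambda>\<omega>. (U1 \<omega>, U2 \<omega>)) (borel \<Otimes>\<^sub>M borel) (\<lambda>\<omega>. (V1 \<omega>, V2 \<omega>))"
    and dU: "distributed M lborel U1 (normal_density 0 \<sigma>)" "distributed M lborel U2 (normal_density 0 \<sigma>)"
    and dV: "distributed M lborel V1 (normal_density 0 \<sigma>)" "distributed M lborel V2 (normal_density 0 \<sigma>)"
  shows "(\<integral>\<^sup>+\<omega>. ennreal \<bar>U2 \<omega> * V1 \<omega> - U1 \<omega> * V2 \<omega>\<bar> \<partial>M) = ennreal (\<sigma>\<^sup>2)"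
proof -
  have [measurable]: "V1 \<in> borel_measurable M" "V2 \<in> borel_measurable M"
    using distributed_measurable[OF dV(1)] distributed_measurable[OF dV(2)] by auto
  have "(\<integral>\<^sup>+\<omega>. ennreal \<bar>U2 \<omega> * V1 \<omega> - U1 \<omega> * V2 \<omega>\<bar> \<partial>M)
     = (\<integral>\<^sup>+\<omega>'. \<integral>\<^sup>+\<omega>. ennreal \<bar>U2 \<omega> * V1 \<omega>' - U1 \<omega> * V2 \<omega>'\<bar> \<partial>M \<partial>M)"
    using nn_integral_indep_var[OF UV, of "\<lambda>((u1, u2), (v1, v2)). ennreal \<bar>u2 * v1 - u1 * v2\<bar>"]
    by (simp add: case_prod_unfold)
  also have "\<dots> = (\<integral>\<^sup>+\<omega>'. ennreal (\<sigma> * sqrt (2 / pi) * sqrt ((V1 \<omega>')\<^sup>2 + (V2 \<omega>')\<^sup>2)) \<partial>M)"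
  proof (rule nn_integral_cong)
    fix \<omega>'
    show "(\<integral>\<^sup>+\<omega>. ennreal \<bar>U2 \<omega> * V1 \<omega>' - U1 \<omega> * V2 \<omega>'\<bar> \<partial>M)
       = ennreal (\<sigma> * sqrt (2 / pi) * sqrt ((V1 \<omega>')\<^sup>2 + (V2 \<omega>')\<^sup>2))"
      using nn_integral_normal_linear_combination_abs[OF assms(1) U dU, of "- V2 \<omega>'" "V1 \<omega>'"]
      by (simp add: ac_simps)
  qed
  \<comment> \<open>Independence within the \<open>V\<close> pair turns the mean radius into a
    double integral against the two densities.\<close>
  also have "\<dots> = (\<integral>\<^sup>+\<omega>'. \<integral>\<^sup>+\<omega>. ennreal (\<sigma> * sqrt (2 / pi) * sqrt ((V1 \<omega>)\<^sup>2 + (V2 \<omega>')\<^sup>2)) \<partial>M \<partial>M)"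
    using nn_integral_indep_var[OF V, of "\<lambda>(x, z). ennreal (\<sigma> * sqrt (2 / pi) * sqrt (x\<^sup>2 + z\<^sup>2))"]
    by (simp add: case_prod_beta)
  also have "\<dots> = (\<integral>\<^sup>+x. ennreal (normal_density 0 \<sigma> x) * (\<integral>\<^sup>+z. ennreal (normal_density 0 \<sigma> z) *
      ennreal (\<sigma> * sqrt (2 / pi) * sqrt (z\<^sup>2 + x\<^sup>2)) \<partial>lborel) \<partial>lborel)"
    by (subst distributed_nn_integral[OF dV(1), symmetric], simp,
        subst distributed_nn_integral[OF dV(2), symmetric]) simp_all
  also have "\<dots> = (\<integral>\<^sup>+x. ennreal (\<sigma> * sqrt (2 / pi)) *
      (\<integral>\<^sup>+z. ennreal (normal_density 0 \<sigma> x * normal_density 0 \<sigma> z * sqrt (x\<^sup>2 + z\<^sup>2)) \<partial>lborel) \<partial>lborel)"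
    using assms(1)
    by (intro nn_integral_cong)
       (simp add: nn_integral_cmult[symmetric] ennreal_mult'[symmetric] ac_simps)
  also have "\<dots> = ennreal (\<sigma> * sqrt (2 / pi)) * ennreal (\<sigma> * sqrt (pi / 2))"
    by (simp add: nn_integral_cmult nn_integral_normal_radius[OF assms(1)])
  also have "\<dots> = ennreal (\<sigma>\<^sup>2)"
    using assms(1) by (simp add: ennreal_mult'[symmetric] real_sqrt_divide power2_eq_square)
  finally show ?thesis .
qed

section \<open>Square integrability, convergence in probability, and pairwise independence\<close>

lemma integrable_mult_square_integrable:
  fixes f g :: "'a \<Rightarrow> real"
  assumes [measurable]: "f \<in> borel_measurable M" "g \<in> borel_measurable M"
    and "integrable M (\<lambda>\<omega>. (f \<omega>)\<^sup>2)" "integrable M (\<lambda>\<omega>. (g \<omega>)\<^sup>2)"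
  shows "integrable M (\<lambda>\<omega>. f \<omega> * g \<omega>)"
proof (rule Bochner_Integration.integrable_bound)
  show "integrable M (\<lambda>\<omega>. (f \<omega>)\<^sup>2 + (g \<omega>)\<^sup>2)"
    using assms by simp
  have "\<bar>a * b\<bar> \<le> a\<^sup>2 + b\<^sup>2" for a b :: real
  proof -
    have "2 * \<bar>a * b\<bar> \<le> a\<^sup>2 + b\<^sup>2"
      using sum_squares_bound[of "\<bar>a\<bar>" "\<bar>b\<bar>"] by (simp add: abs_mult)
    then show ?thesis by simp
  qed
  then show "AE \<omega> in M. norm (f \<omega> * g \<omega>) \<le> norm ((f \<omega>)\<^sup>2 + (g \<omega>)\<^sup>2)"
    by (intro AE_I2) simp
qed simp

lemma integrable_of_square:
  fixes f :: "'a \<Rightarrow> real"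
  assumes "f \<in> borel_measurable M" "integrable M (\<lambda>\<omega>. (f \<omega>)\<^sup>2)"
  shows "integrable M f"
  using integrable_mult_square_integrable[of f "\<lambda>_. 1"] assms by simp

text \<open>The second moment bound prevents mass from escaping on events of small probability.
  First the limit is shown to be square integrable; then the mean distance is split into a small
  value off the exceptional event, a part controlled by second moments, and a multiple of the
  probability of that event.\<close>

lemma tendsto_expectation_in_probability:
  fixes S :: "nat \<Rightarrow> 'a \<Rightarrow> real" and J :: "'a \<Rightarrow> real"
  assumes S[measurable]: "\<And>n. S n \<in> borel_measurable M" and J[measurable]: "J \<in> borel_measurable M"
    and S2: "\<And>n. integrable M (\<lambda>\<omega>. (S n \<omega>)\<^sup>2)"
    and K: "\<And>n. expectation (\<lambda>\<omega>. (S n \<omega>)\<^sup>2) \<le> K"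
    and lim: "\<And>\<epsilon>. 0 < \<epsilon> \<Longrightarrow> (\<lambda>n. prob {\<omega> \<in> space M. \<epsilon> < \<bar>S n \<omega> - J \<omega>\<bar>}) \<longlonglongrightarrow> 0"
  shows "integrable M (\<lambda>\<omega>. (J \<omega>)\<^sup>2)" and "(\<lambda>n. expectation (S n)) \<longlonglongrightarrow> expectation J"
proof -
  define D where "D n \<omega> = \<bar>S n \<omega> - J \<omega>\<bar>" for n \<omega>
  have [measurable]: "D n \<in> borel_measurable M" for n
    unfolding D_def by measurable
  define A where "A \<epsilon> n = {\<omega> \<in> space M. \<epsilon> < D n \<omega>}" for \<epsilon> n
  have [measurable]: "A \<epsilon> n \<in> sets M" for \<epsilon> n
    unfolding A_def by measurable
  have ind: "integrable M (indicator (A \<epsilon> n) :: 'a \<Rightarrow> real)"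
    "expectation (indicator (A \<epsilon> n)) = prob (A \<epsilon> n)" for \<epsilon> n
    by (auto simp: integrable_indicator_iff less_top[symmetric])
  have limA: "(\<lambda>n. prob (A \<epsilon> n)) \<longlonglongrightarrow> 0" if "0 < \<epsilon>" for \<epsilon>
    using lim[OF that] by (simp add: A_def D_def)
  have J_le: "(J \<omega>)\<^sup>2 \<le> 2 * (S n \<omega>)\<^sup>2 + 2 * (D n \<omega>)\<^sup>2" for n \<omega>
  proof -
    have "(b::real)\<^sup>2 \<le> 2 * a\<^sup>2 + 2 * (a - b)\<^sup>2" for a b
      using zero_le_power2[of "2 * a - b"] by (simp add: power2_eq_square algebra_simps)
    then show ?thesis by (simp add: D_def)
  qed
  \<comment> \<open>Bounding \<open>min (J\<^sup>2) i\<close> uniformly in \<open>i\<close> gives \<open>J \<in> L\<^sup>2\<close> without passing to an almost surely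
    convergent subsequence.\<close>
  define trunc where "trunc i \<omega> = min ((J \<omega>)\<^sup>2) (real i)" for i \<omega>
  have [measurable]: "trunc i \<in> borel_measurable M" for i
    unfolding trunc_def by measurable
  have trunc_int: "integrable M (trunc i)" for i
    by (rule integrable_const_bound[of _ "real i"]) (auto simp: trunc_def)
  have trunc_bound: "expectation (trunc i) \<le> 2 * K + 2" for i
  proof -
    \<comment> \<open>Off \<open>A 1 n\<close> the distance is at most 1, so \<open>J_le\<close>
      gives the first two terms; on it the truncation is at most \<open>i\<close>. With
      \<open>i\<close> fixed, the last term vanishes as \<open>n\<close> grows.\<close>
    have "expectation (trunc i) \<le> 2 * K + 2 + real i * prob (A 1 n)" for n
    proof -
      have "expectation (trunc i) \<le> expectation (\<lambda>\<omega>. 2 * (S n \<omega>)\<^sup>2 + 2 + real i * indicator (A 1 n) \<omega>)"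
      proof (rule integral_mono[OF trunc_int])
        show "integrable M (\<lambda>\<omega>. 2 * (S n \<omega>)\<^sup>2 + 2 + real i * indicator (A 1 n) \<omega>)"
          using S2 ind by simp
        fix \<omega> assume "\<omega> \<in> space M"
        show "trunc i \<omega> \<le> 2 * (S n \<omega>)\<^sup>2 + 2 + real i * indicator (A 1 n) \<omega>"
        proof (cases "\<omega> \<in> A 1 n")
          case True
          then show ?thesis by (simp add: trunc_def min.coboundedI2)
        next
          case False
          then have "(D n \<omega>)\<^sup>2 \<le> 1"
            using \<open>\<omega> \<in> space M\<close> by (auto simp: A_def D_def abs_square_le_1)
          then show ?thesis
            using False J_le[of \<omega> n] by (simp add: trunc_def)
        qed
      qed
      also have "\<dots> = 2 * expectation (\<lambda>\<omega>. (S n \<omega>)\<^sup>2) + 2 + real i * prob (A 1 n)"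
        using S2 ind by (simp add: prob_space)
      finally show ?thesis
        using K[of n] by simp
    qed
    moreover have "(\<lambda>n. 2 * K + 2 + real i * prob (A 1 n)) \<longlonglongrightarrow> 2 * K + 2 + real i * 0"
      by (intro tendsto_intros limA) simp
    ultimately show ?thesis
      by (auto intro: LIMSEQ_le_const)
  qed
  show J2: "integrable M (\<lambda>\<omega>. (J \<omega>)\<^sup>2)"
  proof -
    have "incseq (\<lambda>i. expectation (trunc i))"
      by (intro incseq_SucI integral_mono trunc_int) (auto simp: trunc_def)
    then obtain l where l: "(\<lambda>i. expectation (trunc i)) \<longlonglongrightarrow> l"
      using incseq_convergent trunc_bound by blast
    show ?thesis
    proof (rule integrable_monotone_convergence[OF trunc_int _ _ l])
      show "AE \<omega> in M. mono (\<lambda>i. trunc i \<omega>)"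
        by (auto simp: trunc_def mono_def)
      have "(\<lambda>i. trunc i \<omega>) \<longlonglongrightarrow> (J \<omega>)\<^sup>2" for \<omega>
      proof (rule tendsto_eventually)
        obtain m :: nat where "(J \<omega>)\<^sup>2 \<le> real m"
          using real_arch_simple by blast
        then show "\<forall>\<^sub>F i in sequentially. trunc i \<omega> = (J \<omega>)\<^sup>2"
          by (intro eventually_sequentiallyI[of m]) (auto simp: trunc_def min_def)
      qed
      then show "AE \<omega> in M. (\<lambda>i. trunc i \<omega>) \<longlonglongrightarrow> (J \<omega>)\<^sup>2"
        by simp
    qed simp
  qed
  \<comment> \<open>A bound for the second moments of all \<open>D n\<close>, from (a - b)^2 \<le> 2
    a^2 + 2 b^2.\<close>
  define C where "C = 2 * K + 2 * expectation (\<lambda>\<omega>. (J \<omega>)\<^sup>2)"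
  have D2_le: "(D n \<omega>)\<^sup>2 \<le> 2 * (S n \<omega>)\<^sup>2 + 2 * (J \<omega>)\<^sup>2" for n \<omega>
    using zero_le_power2[of "S n \<omega> + J \<omega>"] by (simp add: D_def power2_eq_square algebra_simps)
  have D2: "integrable M (\<lambda>\<omega>. (D n \<omega>)\<^sup>2)" for n
    by (rule Bochner_Integration.integrable_bound[where f="\<lambda>\<omega>. 2 * (S n \<omega>)\<^sup>2 + 2 * (J \<omega>)\<^sup>2"])
       (use S2 J2 D2_le in auto)
  have D2_bound: "expectation (\<lambda>\<omega>. (D n \<omega>)\<^sup>2) \<le> C" for n
  proof -
    have "expectation (\<lambda>\<omega>. (D n \<omega>)\<^sup>2) \<le> expectation (\<lambda>\<omega>. 2 * (S n \<omega>)\<^sup>2 + 2 * (J \<omega>)\<^sup>2)"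
      using S2 J2 D2 D2_le by (intro integral_mono) auto
    then show ?thesis
      using K[of n] S2[of n] J2 by (simp add: C_def)
  qed
  have "0 \<le> C"
    using D2_bound[of 0] by (rule order_trans[rotated]) simp
  have bound: "\<bar>expectation (S n) - expectation J\<bar> \<le> \<epsilon> + C / L + L * prob (A \<epsilon> n)"
    if "0 < \<epsilon>" "0 < L" for \<epsilon> L n
  proof -
    have "\<bar>expectation (S n) - expectation J\<bar> = \<bar>expectation (\<lambda>\<omega>. S n \<omega> - J \<omega>)\<bar>"
      using integrable_of_square[OF S S2] integrable_of_square[OF J J2] by simp
    also have "\<dots> \<le> expectation (D n)"
      unfolding D_def by (rule integral_abs_bound)
    also have "\<dots> \<le> expectation (\<lambda>\<omega>. \<epsilon> + (D n \<omega>)\<^sup>2 / L + L * indicator (A \<epsilon> n) \<omega>)"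
    proof (rule integral_mono)
      show "integrable M (D n)"
        by (rule integrable_of_square[OF _ D2]) simp
      show "integrable M (\<lambda>\<omega>. \<epsilon> + (D n \<omega>)\<^sup>2 / L + L * indicator (A \<epsilon> n) \<omega>)"
        using D2 ind by simp
      fix \<omega> assume "\<omega> \<in> space M"
      have "0 \<le> (D n \<omega>)\<^sup>2 / L"
        using that by simp
      show "D n \<omega> \<le> \<epsilon> + (D n \<omega>)\<^sup>2 / L + L * indicator (A \<epsilon> n) \<omega>"
      proof (cases "\<omega> \<in> A \<epsilon> n")
        case True
        \<comment> \<open>A square is completed so that, after division by \<open>L\<close>, the
          distance is bounded by a small multiple of its square plus a constant that is charged only
          on \<open>A \<epsilon> n\<close>.\<close>
        have "D n \<omega> * L \<le> (D n \<omega>)\<^sup>2 + L\<^sup>2"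
          using zero_le_power2[of "2 * D n \<omega> - L"] by (simp add: power2_eq_square algebra_simps)
            (use zero_le_square[of L] in linarith)
        then have "D n \<omega> \<le> (D n \<omega>)\<^sup>2 / L + L"
          using that by (simp add: field_simps power2_eq_square)
        then show ?thesis using True that by simp
      next
        case False
        then have "D n \<omega> \<le> \<epsilon>"
          using \<open>\<omega> \<in> space M\<close> by (auto simp: A_def)
        then show ?thesis using False \<open>0 \<le> (D n \<omega>)\<^sup>2 / L\<close> by simp
      qed
    qed
    also have "\<dots> = \<epsilon> + expectation (\<lambda>\<omega>. (D n \<omega>)\<^sup>2) / L + L * prob (A \<epsilon> n)"
      using D2 ind by (simp add: prob_space)
    also have "\<dots> \<le> \<epsilon> + C / L + L * prob (A \<epsilon> n)"
      using D2_bound[of n] that by (simp add: divide_right_mono)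
    finally show ?thesis .
  qed
  show "(\<lambda>n. expectation (S n)) \<longlonglongrightarrow> expectation J"
  proof (rule tendstoI)
    fix e :: real assume "0 < e"
    \<comment> \<open>Chosen so that \<open>C / L\<close> is below \<open>e / 3\<close>; the added 1
      keeps \<open>L\<close> positive when \<open>C\<close> is 0. The other two thirds come from the
      threshold \<open>e / 3\<close> and from taking \<open>n\<close> large for this fixed
      \<open>L\<close>.\<close>
    define L where "L = 3 * (C + 1) / e"
    have L: "0 < L" "C / L < e / 3"
      using \<open>0 \<le> C\<close> \<open>0 < e\<close> by (simp_all add: L_def field_simps)
    have "\<forall>\<^sub>F n in sequentially. prob (A (e / 3) n) < e / (3 * L)"
      using order_tendstoD(2)[OF limA] \<open>0 < e\<close> L by simp
    then show "\<forall>\<^sub>F n in sequentially. dist (expectation (S n)) (expectation J) < e"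
    proof eventually_elim
      case (elim n)
      then have "L * prob (A (e / 3) n) < e / 3"
        using L by (simp add: field_simps)
      then show ?case
        using bound[of "e / 3" L n] L \<open>0 < e\<close> unfolding dist_real_def by linarith
    qed
  qed
qed

text \<open>The singleton blocks \<open>{i}\<close> and \<open>{j}\<close> are disjoint, so the
  restricted families are independent; evaluation at the single index recovers the
  variables.\<close>

lemma indep_vars_imp_indep_var:
  assumes "indep_vars N X I" "i \<in> I" "j \<in> I" "i \<noteq> j"
  shows "indep_var (N i) (X i) (N j) (X j)"
proof -
  have "indep_var (PiM {i} N) (\<lambda>\<omega>. restrict (\<lambda>k. X k \<omega>) {i}) (PiM {j} N) (\<lambda>\<omega>. restrict (\<lambda>k. X k \<omega>) {j})"
    using assms by (intro indep_var_restrict[where I=I]) auto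
  then have "indep_var (N i) ((\<lambda>f. f i) \<circ> (\<lambda>\<omega>. restrict (\<lambda>k. X k \<omega>) {i}))
      (N j) ((\<lambda>f. f j) \<circ> (\<lambda>\<omega>. restrict (\<lambda>k. X k \<omega>) {j}))"
    by (rule indep_var_compose) auto
  then show ?thesis
    by (simp add: comp_def)
qed

end

section \<open>Increments of one-dimensional Brownian motion\<close>

context
  fixes M :: "'a measure" and B :: "real \<Rightarrow> 'a \<Rightarrow> real"
  assumes bm: "brownian_motion M B"
begin

interpretation prob_space M
  using bm by (simp add: brownian_motion_def)

lemma brownian_motion_measurable:
  "0 \<le> t \<Longrightarrow> B t \<in> borel_measurable M"
  using bm by (simp add: brownian_motion_def)

lemma brownian_motion_increment_distributed:
  "0 \<le> s \<Longrightarrow> s < t \<Longrightarrow> distributed M lborel (\<lambda>\<omega>. B t \<omega> - B s \<omega>) (normal_density 0 (sqrt (t - s)))"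
  using bm by (simp add: brownian_motion_def)

lemma brownian_motion_increment:
  assumes "0 \<le> s" "s \<le> t"
  shows "integrable M (\<lambda>\<omega>. (B t \<omega> - B s \<omega>)\<^sup>2)"
    and "expectation (\<lambda>\<omega>. B t \<omega> - B s \<omega>) = 0"
    and "expectation (\<lambda>\<omega>. (B t \<omega> - B s \<omega>)\<^sup>2) = t - s"
proof -
  have "integrable M (\<lambda>\<omega>. (B t \<omega> - B s \<omega>)\<^sup>2) \<and> expectation (\<lambda>\<omega>. B t \<omega> - B s \<omega>) = 0 \<and>
      expectation (\<lambda>\<omega>. (B t \<omega> - B s \<omega>)\<^sup>2) = t - s"
  \<comment> \<open>A normal density is available only for \<open>s < t\<close>; for equal times the
    increment is identically 0.\<close>
  proof (cases "s = t")
    case False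
    then have st: "0 < sqrt (t - s)" "s < t"
      using assms by auto
    note D = brownian_motion_increment_distributed[OF assms(1) st(2)]
    have "has_bochner_integral lborel (\<lambda>x. normal_density 0 (sqrt (t - s)) x * x\<^sup>2) (t - s)"
      using normal_second_moment[OF st(1)] st by simp
    then show ?thesis
      using distributed_integral[OF D, of "\<lambda>x. x\<^sup>2"] distributed_integrable[OF D, of "\<lambda>x. x\<^sup>2"]
        normal_distributed_expectation[OF st(1) D]
      by (simp add: has_bochner_integral_iff)
  qed simp
  then show "integrable M (\<lambda>\<omega>. (B t \<omega> - B s \<omega>)\<^sup>2)" "expectation (\<lambda>\<omega>. B t \<omega> - B s \<omega>) = 0"
    "expectation (\<lambda>\<omega>. (B t \<omega> - B s \<omega>)\<^sup>2) = t - s"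
    by auto
qed

lemma brownian_motion_value:
  assumes "0 \<le> t"
  shows "integrable M (\<lambda>\<omega>. (B t \<omega>)\<^sup>2)"
    and "expectation (\<lambda>\<omega>. (B t \<omega>)\<^sup>2) = t"
proof -
  have [measurable]: "B t \<in> borel_measurable M" "B 0 \<in> borel_measurable M"
    using assms by (auto intro: brownian_motion_measurable)
  \<comment> \<open>The process starts at 0 only almost surely, so values are compared with
    increments from time 0 almost everywhere.\<close>
  have ae: "AE \<omega> in M. (B t \<omega> - B 0 \<omega>)\<^sup>2 = (B t \<omega>)\<^sup>2"
    using bm by (auto simp: brownian_motion_def)
  show "integrable M (\<lambda>\<omega>. (B t \<omega>)\<^sup>2)"
    by (rule integrable_cong_AE_imp[OF brownian_motion_increment(1)[of 0 t]]) (use assms ae in auto)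
  show "expectation (\<lambda>\<omega>. (B t \<omega>)\<^sup>2) = t"
    using brownian_motion_increment(3)[of 0 t] assms integral_cong_AE[OF _ _ ae] by simp
qed

lemma brownian_motion_increments_indep:
  assumes "0 \<le> s" "s \<le> t" "t \<le> u" "u \<le> v"
  shows "indep_var borel (\<lambda>\<omega>. B t \<omega> - B s \<omega>) borel (\<lambda>\<omega>. B v \<omega> - B u \<omega>)"
proof -
  \<comment> \<open>The four times bound three consecutive intervals. Increments 0 and 2 are the
    ones wanted; increment 1 bridges the gap from \<open>t\<close> to \<open>u\<close>.\<close>
  define p where "p k = (if k = 0 then s else if k = 1 then t else if k = 2 then u else v)" for k :: nat
  have "0 \<le> p 0 \<and> (\<forall>k<3. p k \<le> p (Suc k))"
    using assms by (auto simp: p_def)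
  then have "indep_vars (\<lambda>_. borel) (\<lambda>k \<omega>. B (p (Suc k)) \<omega> - B (p k) \<omega>) {..<3::nat}"
    using bm unfolding brownian_motion_def by blast
  from indep_vars_imp_indep_var[OF this, of 0 2] show ?thesis
    by (simp add: p_def)
qed

lemma brownian_motion_increments_orthogonal:
  assumes "0 \<le> s" "s \<le> t" "t \<le> u" "u \<le> v"
  shows "expectation (\<lambda>\<omega>. (B t \<omega> - B s \<omega>) * (B v \<omega> - B u \<omega>)) = 0"
proof -
  have [measurable]: "B s \<in> borel_measurable M" "B t \<in> borel_measurable M"
    "B u \<in> borel_measurable M" "B v \<in> borel_measurable M"
    using assms by (auto intro!: brownian_motion_measurable)
  have "integrable M (\<lambda>\<omega>. B t \<omega> - B s \<omega>)" "integrable M (\<lambda>\<omega>. B v \<omega> - B u \<omega>)"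
    using assms by (auto intro!: integrable_of_square brownian_motion_increment(1))
  then show ?thesis
    using assms brownian_motion_increments_indep[OF assms]
    by (subst indep_var_lebesgue_integral) (auto simp: brownian_motion_increment(2))
qed

end

section \<open>Independence of the two coordinates and mixed products\<close>

locale planar_brownian_motion = prob_space M for M :: "'a measure" +
  fixes W :: "real \<Rightarrow> 'a \<Rightarrow> real ^ 2"
  assumes std: "std_brownian_motion M W"
begin

lemma coordinate: "brownian_motion M (\<lambda>t \<omega>. W t \<omega> $ i)"
  using std by (simp add: std_brownian_motion_def)

lemmas increment_distributed = brownian_motion_increment_distributed[OF coordinate]
lemmas increment = brownian_motion_increment[OF coordinate]
lemmas val = brownian_motion_value[OF coordinate]
lemmas increments_indep = brownian_motion_increments_indep[OF coordinate]
lemmas increments_orthogonal = brownian_motion_increments_orthogonal[OF coordinate]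

lemma coordinate_measurable[measurable (raw)]: "0 \<le> t \<Longrightarrow> (\<lambda>\<omega>. W t \<omega> $ i) \<in> borel_measurable M"
  by (rule brownian_motion_measurable[OF coordinate])

text \<open>Independence holds for entire paths, so it passes to any measurable functionals of them.
  Each later use picks \<open>F\<close> and \<open>G\<close> reading finitely many times.\<close>

lemma indep_coordinates:
  assumes "F \<in> measurable (\<Pi>\<^sub>M t\<in>{0..}. borel) N" "G \<in> measurable (\<Pi>\<^sub>M t\<in>{0..}. borel) N'"
  shows "indep_var N (\<lambda>\<omega>. F (\<lambda>t\<in>{0..}. W t \<omega> $ 1)) N' (\<lambda>\<omega>. G (\<lambda>t\<in>{0..}. W t \<omega> $ 2))"
proof -
  have "indep_vars (\<lambda>i. \<Pi>\<^sub>M t\<in>{0..}. borel) (\<lambda>i \<omega>. \<lambda>t\<in>{0..}. W t \<omega> $ i) (UNIV :: 2 set)"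
    using std by (simp add: std_brownian_motion_def)
  from indep_vars_imp_indep_var[OF this, of 1 2] have
    "indep_var (\<Pi>\<^sub>M t\<in>{0..}. borel) (\<lambda>\<omega>. \<lambda>t\<in>{0..}. W t \<omega> $ 1) (\<Pi>\<^sub>M t\<in>{0..}. borel) (\<lambda>\<omega>. \<lambda>t\<in>{0..}. W t \<omega> $ 2)"
    by simp
  from indep_var_compose[OF this assms] show ?thesis
    by (simp add: comp_def)
qed

text \<open>The expectation factors and the increment is centred. The time \<open>s\<close> may be
  the right end of the interval from \<open>r\<close> to \<open>t\<close>, since the factors come
  from different coordinates; hence the Stratonovich average creates no correction term.\<close>

lemma product_mean_zero:
  assumes "0 \<le> s" "0 \<le> r" "r \<le> t"
  shows "integrable M (\<lambda>\<omega>. W s \<omega> $ 1 * (W t \<omega> $ 2 - W r \<omega> $ 2))"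
    and "expectation (\<lambda>\<omega>. W s \<omega> $ 1 * (W t \<omega> $ 2 - W r \<omega> $ 2)) = 0"
proof -
  have ind: "indep_var borel (\<lambda>\<omega>. W s \<omega> $ 1) borel (\<lambda>\<omega>. W t \<omega> $ 2 - W r \<omega> $ 2)"
    using assms indep_coordinates[of "\<lambda>f. f s" borel "\<lambda>f. f t - f r" borel] by simp
  have int: "integrable M (\<lambda>\<omega>. W s \<omega> $ 1)" "integrable M (\<lambda>\<omega>. W t \<omega> $ 2 - W r \<omega> $ 2)"
    using assms by (auto intro!: integrable_of_square val increment)
  show "integrable M (\<lambda>\<omega>. W s \<omega> $ 1 * (W t \<omega> $ 2 - W r \<omega> $ 2))"
    using indep_var_integrable[OF ind int] .
  show "expectation (\<lambda>\<omega>. W s \<omega> $ 1 * (W t \<omega> $ 2 - W r \<omega> $ 2)) = 0"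
    using assms by (simp add: indep_var_lebesgue_integral[OF ind int] increment)
qed

lemma nn_integral_levy_area_abs:
  assumes "0 \<le> a" "0 < d"
  shows "(\<integral>\<^sup>+\<omega>. ennreal \<bar>(W (a + 2 * d) \<omega> $ 1 - W (a + d) \<omega> $ 1) * (W (a + d) \<omega> $ 2 - W a \<omega> $ 2)
      - (W (a + d) \<omega> $ 1 - W a \<omega> $ 1) * (W (a + 2 * d) \<omega> $ 2 - W (a + d) \<omega> $ 2)\<bar> \<partial>M) = ennreal d"
proof -
  \<comment> \<open>The same functional, the pair of increments over two adjacent intervals of
    length \<open>d\<close>, is applied to both coordinates.\<close>
  let ?F = "\<lambda>f :: real \<Rightarrow> real. (f (a + d) - f a, f (a + 2 * d) - f (a + d))"
  have [measurable]: "?F \<in> measurable (\<Pi>\<^sub>M t\<in>{0..}. borel) (borel \<Otimes>\<^sub>M borel)"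
    using assms by simp
  have UV: "indep_var (borel \<Otimes>\<^sub>M borel)
      (\<lambda>\<omega>. (W (a + d) \<omega> $ 1 - W a \<omega> $ 1, W (a + 2 * d) \<omega> $ 1 - W (a + d) \<omega> $ 1))
      (borel \<Otimes>\<^sub>M borel)
      (\<lambda>\<omega>. (W (a + d) \<omega> $ 2 - W a \<omega> $ 2, W (a + 2 * d) \<omega> $ 2 - W (a + d) \<omega> $ 2))"
    using assms indep_coordinates[of ?F _ ?F] by simp
  have ind: "indep_var borel (\<lambda>\<omega>. W (a + d) \<omega> $ i - W a \<omega> $ i)
      borel (\<lambda>\<omega>. W (a + 2 * d) \<omega> $ i - W (a + d) \<omega> $ i)" for i
    using assms by (intro increments_indep) auto
  have distr1: "distributed M lborel (\<lambda>\<omega>. W (a + d) \<omega> $ i - W a \<omega> $ i) (normal_density 0 (sqrt d))"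
    and distr2: "distributed M lborel (\<lambda>\<omega>. W (a + 2 * d) \<omega> $ i - W (a + d) \<omega> $ i) (normal_density 0 (sqrt d))" for i
    using assms increment_distributed[of a "a + d" i] increment_distributed[of "a + d" "a + 2 * d" i] by auto
  show ?thesis
    using nn_integral_normal_determinant_abs[OF _ ind ind UV distr1 distr2 distr1 distr2] assms by simp
qed

section \<open>Mean of one step of the scheme\<close>

text \<open>Here \<open>d\<close> is half a step, so \<open>d / 4\<close> is one eighth of the step
  size. Everything but the absolute difference of the candidates is a sum of mixed products of mean
  0.\<close>

lemma heun_max_step:
  assumes "0 \<le> a" "0 < d"
  defines "step \<equiv> \<lambda>\<omega>. max
      (1/2 * (W a \<omega> $ 1 + W (a + 2 * d) \<omega> $ 1) * (W (a + 2 * d) \<omega> $ 2 - W a \<omega> $ 2))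
      (1/2 * (W a \<omega> $ 1 + W (a + d) \<omega> $ 1) * (W (a + d) \<omega> $ 2 - W a \<omega> $ 2)
        + 1/2 * (W (a + d) \<omega> $ 1 + W (a + 2 * d) \<omega> $ 1) * (W (a + 2 * d) \<omega> $ 2 - W (a + d) \<omega> $ 2))"
  shows "integrable M step" and "expectation step = d / 4"
proof -
  define area where "area \<omega> = (W (a + 2 * d) \<omega> $ 1 - W (a + d) \<omega> $ 1) * (W (a + d) \<omega> $ 2 - W a \<omega> $ 2)
      - (W (a + d) \<omega> $ 1 - W a \<omega> $ 1) * (W (a + 2 * d) \<omega> $ 2 - W (a + d) \<omega> $ 2)" for \<omega>
  have [measurable]: "area \<in> borel_measurable M"
    using assms(1,2) unfolding area_def
    by (intro borel_measurable_diff borel_measurable_times coordinate_measurable) auto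
  have "has_bochner_integral M (\<lambda>\<omega>. \<bar>area \<omega>\<bar>) d"
    using assms(2) nn_integral_levy_area_abs[OF assms(1,2)]
    by (intro has_bochner_integral_nn_integral) (auto simp: area_def[symmetric])
  then have area: "integrable M (\<lambda>\<omega>. \<bar>area \<omega>\<bar>)" "expectation (\<lambda>\<omega>. \<bar>area \<omega>\<bar>) = d"
    by (auto simp: has_bochner_integral_iff)
  let ?P = "\<lambda>s r t \<omega>. W s \<omega> $ 1 * (W t \<omega> $ 2 - W r \<omega> $ 2)"
  define c where "c = a + 2 * d"
  define m where "m = a + d"
  have ord: "0 \<le> a" "a \<le> m" "m \<le> c" "0 \<le> m" "0 \<le> c" "a \<le> c"
    using assms(1,2) by (auto simp: c_def m_def)
  \<comment> \<open>Multiplying out both candidates leaves six terms, each a value of the first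
    coordinate times an increment of the second. Half the absolute difference
    \<open>\<bar>area \<omega> / 2\<bar>\<close> supplies the last term.\<close>
  have step: "step = (\<lambda>\<omega>. (?P a a c \<omega> + ?P c a c \<omega> + ?P a a m \<omega> + ?P m a m \<omega> + ?P m m c \<omega> + ?P c m c \<omega>
      + \<bar>area \<omega>\<bar>) / 4)"
  proof
    fix \<omega>
    have max_eq: "max u v = (u + v + \<bar>u - v\<bar>) / 2" for u v :: real
      by (simp add: max_def)
    let ?u = "1/2 * (W a \<omega> $ 1 + W c \<omega> $ 1) * (W c \<omega> $ 2 - W a \<omega> $ 2)"
    let ?v = "1/2 * (W a \<omega> $ 1 + W m \<omega> $ 1) * (W m \<omega> $ 2 - W a \<omega> $ 2)
        + 1/2 * (W m \<omega> $ 1 + W c \<omega> $ 1) * (W c \<omega> $ 2 - W m \<omega> $ 2)"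
    have "?u - ?v = area \<omega> / 2"
      unfolding area_def c_def[symmetric] m_def[symmetric] by (simp add: field_simps)
    then have "max ?u ?v = (?u + ?v + \<bar>area \<omega> / 2\<bar>) / 2"
      by (simp only: max_eq)
    also have "\<dots> = (?P a a c \<omega> + ?P c a c \<omega> + ?P a a m \<omega> + ?P m a m \<omega> + ?P m m c \<omega> + ?P c m c \<omega>
      + \<bar>area \<omega>\<bar>) / 4"
      by (simp add: field_simps)
    finally show "step \<omega> = (?P a a c \<omega> + ?P c a c \<omega> + ?P a a m \<omega> + ?P m a m \<omega> + ?P m m c \<omega> + ?P c m c \<omega>
      + \<bar>area \<omega>\<bar>) / 4"
      by (simp add: step_def c_def m_def)
  qed
  have P: "integrable M (?P a a c)" "integrable M (?P c a c)" "integrable M (?P a a m)"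
    "integrable M (?P m a m)" "integrable M (?P m m c)" "integrable M (?P c m c)"
    "expectation (?P a a c) = 0" "expectation (?P c a c) = 0" "expectation (?P a a m) = 0"
    "expectation (?P m a m) = 0" "expectation (?P m m c) = 0" "expectation (?P c m c) = 0"
    using ord by (auto intro!: product_mean_zero)
  show "integrable M step"
    unfolding step using P area by (intro integrable_divide Bochner_Integration.integrable_add)
  show "expectation step = d / 4"
    unfolding step using P area by simp
qed

section \<open>Stratonovich sums and the mean of the solution\<close>

text \<open>Expanding the square, independence separates the averages \<open>c\<close> from the
  increments \<open>D\<close>, and orthogonality of the increments leaves only the diagonal, which
  telescopes. The bound depends on the final time alone, hence is uniform over partitions of a fixed
  interval.\<close>

lemma stratonovich_sum:
  assumes "0 \<le> p 0" and mono: "\<And>k. k < n \<Longrightarrow> p k \<le> p (Suc k)"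
  defines "S \<equiv> \<lambda>\<omega>. \<Sum>k<n. (W (p k) \<omega> $ 1 + W (p (Suc k)) \<omega> $ 1) / 2 * (W (p (Suc k)) \<omega> $ 2 - W (p k) \<omega> $ 2)"
  shows "expectation S = 0" and "integrable M (\<lambda>\<omega>. (S \<omega>)\<^sup>2)"
    and "expectation (\<lambda>\<omega>. (S \<omega>)\<^sup>2) \<le> (p n)\<^sup>2"
proof -
  define c where "c k \<omega> = (W (p k) \<omega> $ 1 + W (p (Suc k)) \<omega> $ 1) / 2" for k \<omega>
  define D where "D k \<omega> = W (p (Suc k)) \<omega> $ 2 - W (p k) \<omega> $ 2" for k \<omega>
  have p_mono: "p i \<le> p j" if "i \<le> j" "j \<le> n" for i j
    using that
  proof (induction rule: dec_induct)
    case (step k)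
    then show ?case using mono[of k] by simp
  qed simp
  have p_pos: "0 \<le> p k" if "k \<le> n" for k
    using p_mono[of 0 k] that assms(1) by simp
  have S_eq: "S \<omega> = (\<Sum>k<n. c k \<omega> * D k \<omega>)" for \<omega>
    by (simp add: S_def c_def D_def)
  have [measurable]: "c k \<in> borel_measurable M" "D k \<in> borel_measurable M" if "k < n" for k
    using that p_pos[of k] p_pos[of "Suc k"] unfolding c_def D_def
    by (auto intro!: borel_measurable_diff borel_measurable_add borel_measurable_divide coordinate_measurable)
  have D2: "integrable M (\<lambda>\<omega>. (D k \<omega>)\<^sup>2)" "expectation (\<lambda>\<omega>. (D k \<omega>)\<^sup>2) = p (Suc k) - p k"
    if "k < n" for k
    using that p_pos[of k] mono[of k] unfolding D_def by (auto intro!: increment)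
  have c_le: "(c k \<omega>)\<^sup>2 \<le> ((W (p k) \<omega> $ 1)\<^sup>2 + (W (p (Suc k)) \<omega> $ 1)\<^sup>2) / 2" for k \<omega>
  proof -
    have "((u + v) / 2)\<^sup>2 \<le> (u\<^sup>2 + v\<^sup>2) / 2" for u v :: real
      using sum_squares_bound[of u v] by (simp add: power2_eq_square field_simps)
    then show ?thesis by (simp add: c_def)
  qed
  have c2: "integrable M (\<lambda>\<omega>. (c k \<omega>)\<^sup>2)" "expectation (\<lambda>\<omega>. (c k \<omega>)\<^sup>2) \<le> p n" if "k < n" for k
  proof -
    have int: "integrable M (\<lambda>\<omega>. ((W (p k) \<omega> $ 1)\<^sup>2 + (W (p (Suc k)) \<omega> $ 1)\<^sup>2) / 2)"
      using that p_pos by (simp add: val)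
    show 1: "integrable M (\<lambda>\<omega>. (c k \<omega>)\<^sup>2)"
      by (rule Bochner_Integration.integrable_bound[OF int]) (use that c_le in auto)
    have "expectation (\<lambda>\<omega>. (c k \<omega>)\<^sup>2) \<le> expectation (\<lambda>\<omega>. ((W (p k) \<omega> $ 1)\<^sup>2 + (W (p (Suc k)) \<omega> $ 1)\<^sup>2) / 2)"
      using 1 int c_le by (rule integral_mono)
    also have "\<dots> = (p k + p (Suc k)) / 2"
      using that p_pos by (simp add: val)
    also have "\<dots> \<le> p n"
      using that p_mono[of k n] p_mono[of "Suc k" n] by simp
    finally show "expectation (\<lambda>\<omega>. (c k \<omega>)\<^sup>2) \<le> p n" .
  qed
  have cc: "integrable M (\<lambda>\<omega>. c j \<omega> * c k \<omega>)" and DD: "integrable M (\<lambda>\<omega>. D j \<omega> * D k \<omega>)"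
    if "j < n" "k < n" for j k
    using that c2 D2 by (auto intro!: integrable_mult_square_integrable)
  \<comment> \<open>The averages at both indices form one functional of the first path, and the two
    increments one functional of the second.\<close>
  have ind: "indep_var borel (\<lambda>\<omega>. c j \<omega> * c k \<omega>) borel (\<lambda>\<omega>. D j \<omega> * D k \<omega>)" if "j < n" "k < n" for j k
    using that p_pos[of j] p_pos[of "Suc j"] p_pos[of k] p_pos[of "Suc k"]
      indep_coordinates[of "\<lambda>f. (f (p j) + f (p (Suc j))) / 2 * ((f (p k) + f (p (Suc k))) / 2)" borel
        "\<lambda>f. (f (p (Suc j)) - f (p j)) * (f (p (Suc k)) - f (p k))" borel]
    by (simp add: c_def D_def)
  have cross_int: "integrable M (\<lambda>\<omega>. (c j \<omega> * c k \<omega>) * (D j \<omega> * D k \<omega>))"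
    and cross: "expectation (\<lambda>\<omega>. (c j \<omega> * c k \<omega>) * (D j \<omega> * D k \<omega>))
      = expectation (\<lambda>\<omega>. c j \<omega> * c k \<omega>) * expectation (\<lambda>\<omega>. D j \<omega> * D k \<omega>)" if "j < n" "k < n" for j k
    using indep_var_integrable[OF ind cc DD] indep_var_lebesgue_integral[OF ind cc DD] that by auto
  have orth_less: "expectation (\<lambda>\<omega>. D j \<omega> * D k \<omega>) = 0" if "j < k" "k < n" for j k
    unfolding D_def using that p_pos[of j] p_mono[of "Suc j" k] mono[of j] mono[of k]
    by (intro increments_orthogonal) auto
  have orth: "expectation (\<lambda>\<omega>. D j \<omega> * D k \<omega>) = 0" if "j \<noteq> k" "j < n" "k < n" for j k
    using orth_less[of j k] orth_less[of k j] that by (cases j k rule: linorder_cases) (auto simp: mult.commute)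
  have square: "(S \<omega>)\<^sup>2 = (\<Sum>j<n. \<Sum>k<n. (c j \<omega> * c k \<omega>) * (D j \<omega> * D k \<omega>))" for \<omega>
    by (simp add: S_eq power2_eq_square sum_product ac_simps)
  show "integrable M (\<lambda>\<omega>. (S \<omega>)\<^sup>2)"
    unfolding square by (intro Bochner_Integration.integrable_sum cross_int) auto
  have "expectation (\<lambda>\<omega>. (S \<omega>)\<^sup>2) = (\<Sum>j<n. \<Sum>k<n. expectation (\<lambda>\<omega>. (c j \<omega> * c k \<omega>) * (D j \<omega> * D k \<omega>)))"
    unfolding square
    by (subst Bochner_Integration.integral_sum)
       (auto intro!: sum.cong Bochner_Integration.integral_sum Bochner_Integration.integrable_sum cross_int)
  also have "\<dots> = (\<Sum>j<n. \<Sum>k<n. if k = j then expectation (\<lambda>\<omega>. (c j \<omega>)\<^sup>2) * (p (Suc j) - p j) else 0)"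
    by (intro sum.cong refl) (auto simp: cross orth D2 power2_eq_square[symmetric])
  also have "\<dots> = (\<Sum>j<n. expectation (\<lambda>\<omega>. (c j \<omega>)\<^sup>2) * (p (Suc j) - p j))"
    by simp
  also have "\<dots> \<le> (\<Sum>j<n. p n * (p (Suc j) - p j))"
    using c2 mono by (intro sum_mono mult_right_mono) auto
  also have "\<dots> = p n * (p n - p 0)"
    by (simp add: sum_distrib_left[symmetric] sum_lessThan_telescope)
  also have "\<dots> \<le> (p n)\<^sup>2"
    using p_pos[of n] assms(1) by (simp add: power2_eq_square mult_left_mono)
  finally show "expectation (\<lambda>\<omega>. (S \<omega>)\<^sup>2) \<le> (p n)\<^sup>2" .
  have prod: "integrable M (\<lambda>\<omega>. W (p k) \<omega> $ 1 * D k \<omega>)" "expectation (\<lambda>\<omega>. W (p k) \<omega> $ 1 * D k \<omega>) = 0"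
    "integrable M (\<lambda>\<omega>. W (p (Suc k)) \<omega> $ 1 * D k \<omega>)" "expectation (\<lambda>\<omega>. W (p (Suc k)) \<omega> $ 1 * D k \<omega>) = 0"
    if "k < n" for k
    using that p_pos mono unfolding D_def by (auto intro!: product_mean_zero)
  have term_eq: "c k \<omega> * D k \<omega> = (W (p k) \<omega> $ 1 * D k \<omega> + W (p (Suc k)) \<omega> $ 1 * D k \<omega>) / 2" for k \<omega>
    by (simp add: c_def algebra_simps add_divide_distrib)
  show "expectation S = 0"
    unfolding S_eq[abs_def] term_eq using prod by (simp add: Bochner_Integration.integral_sum)
qed

text \<open>At each time \<open>x\<close> agrees almost surely with the first coordinate, so the
  sums defining the integral inherit mean 0 and the uniform second moment bound. Their limit in
  probability then has mean 0.\<close>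

lemma strat_sde_solution_expectation:
  assumes "0 < T" and sol: "strat_sde_solution M W T x y"
  shows "integrable M (y T)" and "expectation (y T) = 0"
proof -
  define J where "J \<omega> = y T \<omega> - y 0 \<omega>" for \<omega>
  have [measurable]: "x t \<in> borel_measurable M" "y t \<in> borel_measurable M" if "t \<in> {0..T}" for t
    using sol that by (auto simp: strat_sde_solution_def)
  have [measurable]: "y T \<in> borel_measurable M" "y 0 \<in> borel_measurable M"
    using assms(1) by auto
  then have [measurable]: "J \<in> borel_measurable M"
    unfolding J_def by measurable
  have int: "has_stratonovich_integral M x (\<lambda>s \<omega>. W s \<omega> $ 2) 0 T J"
    using sol assms(1) by (auto simp: strat_sde_solution_def J_def[abs_def])
  have J_eq: "AE \<omega> in M. J \<omega> = y T \<omega>"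
    using sol by (auto simp: strat_sde_solution_def J_def)
  have x_eq: "AE \<omega> in M. x t \<omega> = W t \<omega> $ 1" if "t \<in> {0..T}" for t
  proof -
    have "AE \<omega> in M. x 0 \<omega> = 0" "AE \<omega> in M. x t \<omega> - x 0 \<omega> = W t \<omega> $ 1 - W 0 \<omega> $ 1"
      using sol that by (auto simp: strat_sde_solution_def)
    moreover have "AE \<omega> in M. W 0 \<omega> $ 1 = 0"
      using coordinate[of 1] by (simp add: brownian_motion_def)
    ultimately show ?thesis
      by eventually_elim simp
  qed
  \<comment> \<open>Uniform partitions into \<open>Suc n\<close> pieces, so that division by 0 does
    not occur at \<open>n = 0\<close>.\<close>
  define p where "p n k = real k * T / real (Suc n)" for n k
  have p_range: "p n k \<in> {0..T}" if "k \<le> Suc n" for n k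
    using that assms(1) by (auto simp: p_def divide_simps)
  have p_diff: "p n (Suc k) - p n k = T / real (Suc n)" for n k
    by (simp add: p_def diff_divide_distrib[symmetric] algebra_simps)
  have p_mono: "p n k \<le> p n (Suc k)" for n k
    using p_diff[of n k] assms(1) by (smt (verit) divide_pos_pos of_nat_0_less_iff zero_less_Suc)
  have p_ends: "p n 0 = 0" "p n (Suc n) = T" for n
    by (simp_all add: p_def)
  \<comment> \<open>The integrand is kept as a parameter: sums with \<open>x\<close> converge by the
    definition of the integral, while sums with the first coordinate have known moments.\<close>
  define R where "R H n \<omega> = (\<Sum>k<Suc n. (H (p n k) \<omega> + H (p n (Suc k)) \<omega>) / 2 *
      (W (p n (Suc k)) \<omega> $ 2 - W (p n k) \<omega> $ 2))" for H n \<omega>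
  let ?S = "R x" and ?S' = "R (\<lambda>t \<omega>. W t \<omega> $ 1)"
  have R_measurable: "R H n \<in> borel_measurable M" if "\<And>t. t \<in> {0..T} \<Longrightarrow> H t \<in> borel_measurable M" for H n
    unfolding R_def using that p_range[of _ n]
    by (intro borel_measurable_sum borel_measurable_times borel_measurable_divide borel_measurable_add
        borel_measurable_diff coordinate_measurable borel_measurable_const) auto
  have [measurable]: "?S n \<in> borel_measurable M" "?S' n \<in> borel_measurable M" for n
    by (auto intro!: R_measurable)
  have S_eq: "AE \<omega> in M. ?S' n \<omega> = ?S n \<omega>" for n
  proof -
    \<comment> \<open>Only finitely many nodes occur, so the almost sure equalities at single times
      hold simultaneously.\<close>
    have "AE \<omega> in M. \<forall>k\<in>{..Suc n}. x (p n k) \<omega> = W (p n k) \<omega> $ 1"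
      by (rule AE_finite_allI) (auto intro!: x_eq p_range)
    then show ?thesis
      by eventually_elim (auto simp: R_def intro!: sum.cong)
  qed
  have S'_mean: "expectation (?S' n) = 0" and S'_int: "integrable M (\<lambda>\<omega>. (?S' n \<omega>)\<^sup>2)"
    and S'_bound: "expectation (\<lambda>\<omega>. (?S' n \<omega>)\<^sup>2) \<le> T\<^sup>2" for n
    using stratonovich_sum[of "p n" "Suc n"] p_mono[of n] unfolding R_def[abs_def] p_ends by auto
  have S_mean: "expectation (?S n) = 0" for n
    using S'_mean[of n] integral_cong_AE[OF _ _ S_eq[of n]] by simp
  have S_sq: "AE \<omega> in M. (?S' n \<omega>)\<^sup>2 = (?S n \<omega>)\<^sup>2" for n
    using S_eq[of n] by eventually_elim simp
  have S_int: "integrable M (\<lambda>\<omega>. (?S n \<omega>)\<^sup>2)" for n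
    by (rule integrable_cong_AE_imp[OF S'_int[of n]]) (use S_sq[of n] in auto)
  have S_bound: "expectation (\<lambda>\<omega>. (?S n \<omega>)\<^sup>2) \<le> T\<^sup>2" for n
    using S'_bound[of n] integral_cong_AE[OF _ _ S_sq[of n]] by simp
  have lim: "(\<lambda>n. prob {\<omega> \<in> space M. \<epsilon> < \<bar>?S n \<omega> - J \<omega>\<bar>}) \<longlonglongrightarrow> 0" if eps: "0 < \<epsilon>" for \<epsilon>
  proof (rule tendstoI)
    fix \<eta> :: real assume "0 < \<eta>"
    obtain \<delta> where \<delta>: "0 < \<delta>" "\<forall>n p. is_partition 0 T n p \<and> (\<forall>k<n. p (Suc k) - p k < \<delta>) \<longrightarrow>
        prob {\<omega> \<in> space M. \<bar>(\<Sum>k<n. (x (p k) \<omega> + x (p (Suc k)) \<omega>) / 2 *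
          (W (p (Suc k)) \<omega> $ 2 - W (p k) \<omega> $ 2)) - J \<omega>\<bar> > \<epsilon>} < \<eta>"
      using int[unfolded has_stratonovich_integral_def, THEN conjunct2, THEN conjunct2, rule_format,
          OF eps \<open>0 < \<eta>\<close>]
      by (elim exE conjE) (rule that)
    have "(\<lambda>n. T / real (Suc n)) \<longlonglongrightarrow> 0"
      by (rule LIMSEQ_Suc[OF lim_const_over_n])
    then have "\<forall>\<^sub>F n in sequentially. T / real (Suc n) < \<delta>"
      using \<delta>(1) by (rule order_tendstoD(2))
    then show "\<forall>\<^sub>F n in sequentially. dist (prob {\<omega> \<in> space M. \<epsilon> < \<bar>?S n \<omega> - J \<omega>\<bar>}) 0 < \<eta>"
    proof eventually_elim
      case (elim n)
      have "prob {\<omega> \<in> space M. \<epsilon> < \<bar>?S n \<omega> - J \<omega>\<bar>} < \<eta>"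
        unfolding R_def using elim p_diff[of n] p_mono[of n] p_ends[of n]
        by (intro \<delta>(2)[rule_format]) (auto simp: is_partition_def)
      then show ?case by simp
    qed
  qed
  have J2: "integrable M (\<lambda>\<omega>. (J \<omega>)\<^sup>2)" and "(\<lambda>n. expectation (?S n)) \<longlonglongrightarrow> expectation J"
    using tendsto_expectation_in_probability[of ?S J "T\<^sup>2"] S_int S_bound lim by auto
  then have "expectation J = 0"
    by (simp add: S_mean LIMSEQ_const_iff)
  then show "expectation (y T) = 0"
    using integral_cong_AE[OF _ _ J_eq] by simp
  show "integrable M (y T)"
    by (rule integrable_cong_AE_imp[OF integrable_of_square[OF _ J2]]) (use J_eq in auto)
qed

end

section \<open>Summation over the steps of the scheme\<close>

theorem theorem3p1:
  fixes M :: "'a measure"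
    and W :: "real \<Rightarrow> 'a \<Rightarrow> real ^ 2"
    and x y :: "real \<Rightarrow> 'a \<Rightarrow> real"
    and X Y :: "nat \<Rightarrow> 'a \<Rightarrow> real"
    and T h :: real
    and N :: nat
    and t th :: "nat \<Rightarrow> real"
    and W1 W2 :: "real \<Rightarrow> 'a \<Rightarrow> real"
  assumes "prob_space M"
    and "T > 0"
    and "std_brownian_motion M W"
    and "W1 = (\<lambda>s \<omega>. W s \<omega> $ 1)" and "W2 = (\<lambda>s \<omega>. W s \<omega> $ 2)"
    and "strat_sde_solution M W T x y"
    and "N \<ge> 1"
    and "h = T / real N"
    and "t = (\<lambda>k. real k * h)" and "th = (\<lambda>k. (real k + 1/2) * h)"
    and "\<And>\<omega>. \<omega> \<in> space M \<Longrightarrow> X 0 \<omega> = 0"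
    and "\<And>\<omega>. \<omega> \<in> space M \<Longrightarrow> Y 0 \<omega> = 0"
    and "\<And>k \<omega>. k < N \<Longrightarrow> \<omega> \<in> space M \<Longrightarrow>
           X (Suc k) \<omega> = X k \<omega> + W1 (t (Suc k)) \<omega> - W1 (t k) \<omega>"
    and "\<And>k \<omega>. k < N \<Longrightarrow> \<omega> \<in> space M \<Longrightarrow>
           Y (Suc k) \<omega> = max
             (Y k \<omega> + 1/2 * (W1 (t k) \<omega> + W1 (t (Suc k)) \<omega>) * (W2 (t (Suc k)) \<omega> - W2 (t k) \<omega>))
             (Y k \<omega> + 1/2 * (W1 (t k) \<omega> + W1 (th k) \<omega>) * (W2 (th k) \<omega> - W2 (t k) \<omega>)
                    + 1/2 * (W1 (th k) \<omega> + W1 (t (Suc k)) \<omega>) * (W2 (t (Suc k)) \<omega> - W2 (th k) \<omega>))"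
  shows "integrable M (y T) \<and> prob_space.expectation M (y T) = 0 \<and>
         integrable M (Y N) \<and> prob_space.expectation M (Y N) = 1/8 * T"
proof -
  interpret planar_brownian_motion M W
    using assms(1,3) by (simp add: planar_brownian_motion_def planar_brownian_motion_axioms_def)
  define d where "d = h / 2"
  have "0 < d"
    using assms by (simp add: d_def)
  have t: "0 \<le> t k" "t (Suc k) = t k + 2 * d" "th k = t k + d" for k
    using \<open>0 < d\<close> assms(9,10) by (auto simp: d_def field_simps)
  define step where "step k \<omega> = max
      (1/2 * (W1 (t k) \<omega> + W1 (t (Suc k)) \<omega>) * (W2 (t (Suc k)) \<omega> - W2 (t k) \<omega>))
      (1/2 * (W1 (t k) \<omega> + W1 (th k) \<omega>) * (W2 (th k) \<omega> - W2 (t k) \<omega>)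
        + 1/2 * (W1 (th k) \<omega> + W1 (t (Suc k)) \<omega>) * (W2 (t (Suc k)) \<omega> - W2 (th k) \<omega>))" for k \<omega>
  have step: "integrable M (step k)" "expectation (step k) = d / 4" for k
    using heun_max_step[OF t(1)[of k] \<open>0 < d\<close>]
    unfolding step_def[abs_def] t(2,3) assms(4,5) by auto
  \<comment> \<open>Both candidates contain the current value of \<open>Y\<close>, which moves out
    of the maximum; \<open>Y\<close> is thus a plain sum of step increments.\<close>
  have Y_eq: "Y n \<omega> = (\<Sum>k<n. step k \<omega>)" if "\<omega> \<in> space M" "n \<le> N" for n \<omega>
    using that(2)
  proof (induction n)
    case 0
    then show ?case using that(1) assms(12) by simp
  next
    case (Suc n)
    then show ?case
      using assms(14)[of n \<omega>] that(1) by (simp add: step_def max_add_distrib_right add.assoc)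
  qed
  have "integrable M (Y N) \<longleftrightarrow> integrable M (\<lambda>\<omega>. \<Sum>k<N. step k \<omega>)"
    by (rule Bochner_Integration.integrable_cong) (auto simp: Y_eq)
  then have "integrable M (Y N)"
    using step by simp
  moreover have "expectation (Y N) = expectation (\<lambda>\<omega>. \<Sum>k<N. step k \<omega>)"
    by (rule Bochner_Integration.integral_cong) (auto simp: Y_eq)
  \<comment> \<open>Each of the \<open>N\<close> steps contributes \<open>d / 4\<close>, that is
    \<open>h / 8\<close>, and \<open>N\<close> steps of size \<open>h\<close> make up
    \<open>T\<close>.\<close>
  then have "expectation (Y N) = 1/8 * T"
    using step assms(7,8) by (simp add: Bochner_Integration.integral_sum d_def)
  ultimately show ?thesis
    using strat_sde_solution_expectation[OF assms(2,6)] by simp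
qed

end
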